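(* Consider the delta operator $\Delta P(t)=P(t+1)-P(t)$, attached to the binomial sequence $((t)_n)_{n\ge0}$, where $(t)_n=t(t-1)\cdots(t-n+1)$. Then, for every $n \geq 1$, all roots in $\mathbb{C}$ of the deviation polynomial $R_n(t)$ lie on the vertical line $\mathrm{Re}(z)=-\frac{n-1}{2}$.
   Context: Classical additive convolution on the space $\mathbb{C}_n[t]$ of complex polynomials of degree at most $n$ is $(A\boxplus_nB)(z)=\frac1{n!}\sum_{k=0}^nA^{(k)}(0)\,B^{(n-k)}(z)$; it is commutative and associative with unit $t^n$. The deviation polynomial $R_n\in\mathbb{C}_n[t]$ attached to $\Delta$ is the inverse of $(t)_n$ for $\boxplus_n$, i.e. the unique polynomial with $R_n\boxplus_n(t)_n=t^n$. *)

theory Defs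
  imports "HOL-Computational_Algebra.Computational_Algebra"
begin

definition boxplus :: "nat \<Rightarrow> complex poly \<Rightarrow> complex poly \<Rightarrow> complex poly" where
  "boxplus n A B =
     smult (1 / fact n) (\<Sum>k\<le>n. smult (poly ((pderiv ^^ k) A) 0) ((pderiv ^^ (n - k)) B))"

definition forward_difference :: "complex poly \<Rightarrow> complex poly" where
  "forward_difference P = pcompose P [:1, 1:] - P"

definition falling_fact :: "nat \<Rightarrow> complex poly" where
  "falling_fact n = (\<Prod>i<n. [:- of_nat i, 1:])"

text \<open>The description below is proper by \<open>deviation_poly_ex1\<close>.\<close>

definition deviation_poly :: "nat \<Rightarrow> complex poly" where
  "deviation_poly n = (THE R. degree R \<le> n \<and> boxplus n R (falling_fact n) = monom 1 n)"

text \<open>The next two lemmas say that \<open>falling_fact\<close> is the binomial sequence attached to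
  \<open>forward_difference\<close>: each \<open>falling_fact n\<close> is monic of degree \<open>n\<close>, vanishes at \<open>0\<close> for
  positive \<open>n\<close>, and the operator sends it to \<open>n\<close> times its predecessor.\<close>

lemma falling_fact_basic:
  "degree (falling_fact n) = n" "lead_coeff (falling_fact n) = 1"
  "poly (falling_fact n) 0 = (if n = 0 then 1 else 0)"
proof -
  show "degree (falling_fact n) = n"
    unfolding falling_fact_def by (subst degree_prod_eq_sum_degree) auto
  show "lead_coeff (falling_fact n) = 1"
    unfolding falling_fact_def by (subst lead_coeff_prod) auto
  show "poly (falling_fact n) 0 = (if n = 0 then 1 else 0)"
    unfolding falling_fact_def by (auto simp: poly_prod prod_zero_iff)
qed

lemma forward_difference_falling_fact:
  "forward_difference (falling_fact n) = smult (of_nat n) (falling_fact (n - 1))"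
proof (cases n)
  case 0
  then show ?thesis by (simp add: forward_difference_def falling_fact_def pcompose_1)
next
  case (Suc m)
  have shift: "pcompose (falling_fact (Suc m)) [:1, 1:] = [:1, 1:] * falling_fact m" for m
    unfolding falling_fact_def pcompose_prod
    by (subst prod.lessThan_Suc_shift) (simp add: pcompose_pCons)
  have step: "falling_fact (Suc m) = [:- of_nat m, 1:] * falling_fact m"
    by (simp add: falling_fact_def)
  have "[:1, 1:] * falling_fact m - falling_fact (Suc m) =
      ([:1, 1:] - [:- of_nat m, 1:]) * falling_fact m"
    by (simp only: step left_diff_distrib)
  then have "forward_difference (falling_fact (Suc m)) =
      ([:1, 1:] - [:- of_nat m, 1:]) * falling_fact m"
    by (simp only: forward_difference_def shift)
  also have "[:1, 1:] - [:- of_nat m, 1:] = [:of_nat (Suc m) :: complex:]"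
    by simp
  finally show ?thesis using Suc by simp
qed

lemma coeff_boxplus:
  "coeff (boxplus n A B) m =
     (\<Sum>k\<le>n. fact k * coeff A k * (pochhammer (of_nat (Suc m)) (n - k) * coeff B (m + (n - k))))
       / fact n"
proof -
  have "poly ((pderiv ^^ k) A) 0 = fact k * coeff A k" for k
    by (simp add: poly_0_coeff_0 coeff_higher_pderiv pochhammer_fact)
  then show ?thesis
    unfolding boxplus_def by (simp add: coeff_sum coeff_higher_pderiv del: of_nat_Suc)
qed

lemma degree_boxplus_le:
  assumes "degree B \<le> n"
  shows "degree (boxplus n A B) \<le> n"
proof (rule degree_le, intro allI impI)
  fix m assume "n < m"
  then have "coeff B (m + (n - k)) = 0" for k
    using assms by (intro coeff_eq_0) auto
  then show "coeff (boxplus n A B) m = 0"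
    unfolding coeff_boxplus by (simp only: mult_zero_right sum.neutral_const div_0)
qed

text \<open>If \<open>A\<close> has degree at most \<open>n\<close>, then \<open>A = A'(D) t\<^sup>n\<close> where \<open>A'\<close> is the series below
  and \<open>D\<close> is differentiation; the convolution is multiplication of these series.\<close>

definition symbol_fps :: "nat \<Rightarrow> complex poly \<Rightarrow> complex fps" where
  "symbol_fps n A = Abs_fps (\<lambda>j. if j \<le> n then fact (n - j) / fact n * coeff A (n - j) else 0)"

lemma symbol_fps_boxplus:
  assumes B: "degree B \<le> n" and s: "s \<le> n"
  shows "fps_nth (symbol_fps n (boxplus n A B)) s =
    fps_nth (symbol_fps n A * symbol_fps n B) s"
proof -
  let ?t = "\<lambda>k. fact k * coeff A k *
    (pochhammer (of_nat (Suc (n - s))) (n - k) * coeff B (n - s + (n - k)))"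
  have "(\<Sum>k\<le>n. ?t k) = (\<Sum>i\<le>n. ?t (n - i))"
    by (rule sum.reindex_bij_witness[where i = "\<lambda>i. n - i" and j = "\<lambda>i. n - i"]) auto
  also have "\<dots> = (\<Sum>i\<le>s. ?t (n - i))"
  proof (rule sum.mono_neutral_right)
    show "\<forall>i\<in>{..n} - {..s}. ?t (n - i) = 0"
    proof
      fix i assume "i \<in> {..n} - {..s}"
      then have "coeff B (n - s + (n - (n - i))) = 0"
        using B s by (intro coeff_eq_0) auto
      then show "?t (n - i) = 0" by simp
    qed
  qed (use s in auto)
  finally have sum_eq: "(\<Sum>k\<le>n. ?t k) = (\<Sum>i\<le>s. ?t (n - i))" .
  have "fps_nth (symbol_fps n (boxplus n A B)) s =
      (\<Sum>i\<le>s. fact (n - s) / fact n * (?t (n - i) / fact n))"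
  proof -
    have "fps_nth (symbol_fps n (boxplus n A B)) s =
        fact (n - s) / fact n * ((\<Sum>i\<le>s. ?t (n - i)) / fact n)"
      unfolding sum_eq[symmetric] using s by (simp add: symbol_fps_def coeff_boxplus del: of_nat_Suc)
    then show ?thesis by (simp only: sum_divide_distrib sum_distrib_left)
  qed
  also have "\<dots> = (\<Sum>i\<le>s. fps_nth (symbol_fps n A) i * fps_nth (symbol_fps n B) (s - i))"
  proof (rule sum.cong[OF refl])
    fix i assume "i \<in> {..s}"
    then have i: "i \<le> s" "i \<le> n" using s by auto
    have e: "n - s + i = n - (s - i)" "n - (n - i) = i" using i s by auto
    have "fact (n - s) * pochhammer (of_nat (Suc (n - s))) i = (fact (n - s + i) :: complex)"
      using pochhammer_product'[of "1 :: complex" "n - s" i] by (simp add: pochhammer_fact)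
    then have "fact (n - s) * pochhammer (of_nat (Suc (n - s))) i = (fact (n - (s - i)) :: complex)"
      using e by simp
    then show "fact (n - s) / fact n * (?t (n - i) / fact n) =
        fps_nth (symbol_fps n A) i * fps_nth (symbol_fps n B) (s - i)"
      using i s by (simp add: symbol_fps_def e field_simps del: of_nat_Suc)
  qed
  also have "\<dots> = fps_nth (symbol_fps n A * symbol_fps n B) s"
    by (simp add: fps_mult_nth atMost_atLeast0)
  finally show ?thesis .
qed

lemma symbol_fps_eqD:
  assumes "degree A \<le> n" "degree B \<le> n"
    and "\<And>s. s \<le> n \<Longrightarrow> fps_nth (symbol_fps n A) s = fps_nth (symbol_fps n B) s"
  shows "A = B"
proof (rule poly_eqI)
  fix m
  show "coeff A m = coeff B m"
  proof (cases "m \<le> n")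
    case True
    then show ?thesis using assms(3)[of "n - m"] by (simp add: symbol_fps_def)
  next
    case False
    then show ?thesis using assms(1,2) by (simp add: coeff_eq_0)
  qed
qed

lemma symbol_fps_monom: "symbol_fps n (monom 1 n) = 1"
  by (rule fps_ext) (auto simp: symbol_fps_def)

lemma boxplus_inverse_ex1:
  assumes B: "degree B = n" "B \<noteq> 0"
  shows "\<exists>!R. degree R \<le> n \<and> boxplus n R B = monom 1 n"
proof (rule ex_ex1I)
  let ?F = "symbol_fps n B"
  have F: "?F * inverse ?F = 1"
    using B by (intro inverse_mult_eq_1') (auto simp: symbol_fps_def)
  define R where "R = (\<Sum>k\<le>n. monom (fps_nth (inverse ?F) (n - k) * fact n / fact k) k)"
  have cR: "coeff R m = (if m \<le> n then fps_nth (inverse ?F) (n - m) * fact n / fact m else 0)" for m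
    unfolding R_def by (simp add: coeff_sum coeff_monom)
  have dR: "degree R \<le> n" by (rule degree_le) (simp add: cR)
  have sR: "fps_nth (symbol_fps n R) s = fps_nth (inverse ?F) s" if "s \<le> n" for s
    using that by (simp add: symbol_fps_def cR)
  have "boxplus n R B = monom 1 n"
  proof (rule symbol_fps_eqD)
    fix s assume s: "s \<le> n"
    have "fps_nth (symbol_fps n R * ?F) s = fps_nth (inverse ?F * ?F) s"
      unfolding fps_mult_nth using s sR by (intro sum.cong) auto
    then show "fps_nth (symbol_fps n (boxplus n R B)) s = fps_nth (symbol_fps n (monom 1 n)) s"
      using s B F by (simp add: symbol_fps_boxplus symbol_fps_monom mult.commute)
  qed (use B degree_boxplus_le degree_monom_le in auto)
  then show "\<exists>R. degree R \<le> n \<and> boxplus n R B = monom 1 n" using dR by blast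
next
  let ?F = "symbol_fps n B"
  have F: "?F * inverse ?F = 1"
    using B by (intro inverse_mult_eq_1') (auto simp: symbol_fps_def)
  have *: "fps_nth (symbol_fps n R) s = fps_nth (inverse ?F) s"
    if R: "boxplus n R B = monom 1 n" and s: "s \<le> n" for R s
  proof -
    have "fps_nth (symbol_fps n R * ?F) i = fps_nth 1 i" if "i \<le> n" for i
      using symbol_fps_boxplus[of B n i R] that R B by (simp add: symbol_fps_monom)
    then have "fps_nth (symbol_fps n R * ?F * inverse ?F) s = fps_nth (1 * inverse ?F) s"
      unfolding fps_mult_nth[of _ "inverse ?F"] using s by (intro sum.cong) auto
    then show ?thesis using F by (simp add: mult.assoc)
  qed
  fix R S
  assume "degree R \<le> n \<and> boxplus n R B = monom 1 n" "degree S \<le> n \<and> boxplus n S B = monom 1 n"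
  then show "R = S" using * by (intro symbol_fps_eqD[of R n S]) auto
qed

lemma deviation_poly_ex1:
  "\<exists>!R. degree R \<le> n \<and> boxplus n R (falling_fact n) = monom 1 n"
proof (rule boxplus_inverse_ex1)
  show "degree (falling_fact n) = n" by (rule falling_fact_basic)
  show "falling_fact n \<noteq> 0" using falling_fact_basic(2)[of n] by force
qed

lemma deviation_poly:
  "degree (deviation_poly n) \<le> n" "boxplus n (deviation_poly n) (falling_fact n) = monom 1 n"
  using theI'[OF deviation_poly_ex1[of n]] unfolding deviation_poly_def by auto

end

(* Write D for differentiation. The recurrence (t)_{n+1} = (t - n) (t)_n gives
   (t)_n = G(D) t^n with G = exp(x) (x / (exp(x) - 1))^(n+1), so R_n = (1/G)(D) t^n, which up to a
   shift by (n-1)/2 is u(D)^(n+1) t^n with u = (exp(x/2) - exp(-x/2)) / x. Since D t^(m+1) = (m+1) t^m,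
   u(D)^(j+1) t^m is a multiple of the central difference p(t + 1/2) - p(t - 1/2) of
   p = u(D)^j t^(m+1). If all roots of p lie on the imaginary axis and Re z > 0, then z + 1/2 is
   farther from each of them than z - 1/2, so the difference does not vanish at z; symmetrically
   for Re z < 0. *)
theory Submission
  imports Defs
begin

section \<open>Power series in \<open>D\<close> acting on monomials\<close>

text \<open>This is f(D) t^n, because D^k t^n = n!/(n-k)! t^(n-k) and higher derivatives
  vanish.\<close>

definition fps_apply_monom :: "complex fps \<Rightarrow> nat \<Rightarrow> complex poly" where
  "fps_apply_monom f n = (\<Sum>k\<le>n. monom (fps_nth f k * fact n / fact (n - k)) (n - k))"

lemma coeff_fps_apply_monom:
  "coeff (fps_apply_monom f n) m = (if m \<le> n then fps_nth f (n - m) * fact n / fact m else 0)"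
proof -
  have "fps_apply_monom f n = (\<Sum>k\<le>n. monom (fps_nth f (n - k) * fact n / fact k) k)"
    unfolding fps_apply_monom_def
    by (rule sum.reindex_bij_witness[where i = "\<lambda>i. n - i" and j = "\<lambda>i. n - i"]) auto
  then show ?thesis by (simp add: coeff_sum coeff_monom)
qed

lemma degree_fps_apply_monom_le: "degree (fps_apply_monom f n) \<le> n"
  by (rule degree_le) (simp add: coeff_fps_apply_monom)

lemma degree_fps_apply_monom: "fps_nth f 0 \<noteq> 0 \<Longrightarrow> degree (fps_apply_monom f n) = n"
  by (intro antisym degree_fps_apply_monom_le le_degree) (simp add: coeff_fps_apply_monom)

lemma fps_apply_monom_diff:
  "fps_apply_monom (f - g) n = fps_apply_monom f n - fps_apply_monom g n"
  by (rule poly_eqI) (simp add: coeff_fps_apply_monom field_simps)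

lemma fps_apply_monom_one: "fps_apply_monom 1 n = monom 1 n"
  by (rule poly_eqI) (auto simp: coeff_fps_apply_monom coeff_monom)

lemma fps_apply_monom_X_mult:
  "fps_apply_monom (fps_X * f) (Suc n) = smult (of_nat (Suc n)) (fps_apply_monom f n)"
  by (rule poly_eqI) (auto simp: coeff_fps_apply_monom Suc_diff_le le_Suc_eq)

text \<open>Taylor's formula: exp(a D) is translation by \<open>a\<close>. The coefficients are
  compared through the binomial expansion of (t + a)^(n-k).\<close>

lemma pcompose_fps_apply_monom:
  "pcompose (fps_apply_monom f n) [:a, 1:] = fps_apply_monom (fps_exp a * f) n"
proof (rule poly_eqI)
  fix m
  have pow: "pcompose ([:0, 1:] ^ k) [:a, 1:] = [:a, 1:] ^ k" for k
    by (induction k) (simp_all add: pcompose_1 pcompose_mult pcompose_pCons)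
  have "pcompose (fps_apply_monom f n) [:a, 1:] =
      (\<Sum>k\<le>n. smult (fps_nth f k * fact n / fact (n - k)) ([:a, 1:] ^ (n - k)))"
    unfolding fps_apply_monom_def
    by (simp add: pcompose_sum pow monom_altdef pcompose_smult pcompose_pCons)
  moreover have "coeff ([:a, 1:] ^ k) m = of_nat (k choose m) * a ^ (k - m)" for k
    by (cases "m \<le> k")
      (simp_all add: coeff_linear_poly_power coeff_eq_0 degree_linear_power binomial_eq_0)
  ultimately have "coeff (pcompose (fps_apply_monom f n) [:a, 1:]) m =
      (\<Sum>k\<le>n. fps_nth f k * fact n / fact (n - k) *
         (of_nat (n - k choose m) * a ^ (n - k - m)))" (is "_ = (\<Sum>k\<le>n. ?t k)")
    by (simp add: coeff_sum)
  also have "\<dots> = coeff (fps_apply_monom (fps_exp a * f) n) m"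
  proof (cases "m \<le> n")
    case True
    have "(\<Sum>k\<le>n. ?t k) = (\<Sum>k\<le>n - m. ?t k)"
      by (rule sum.mono_neutral_right) auto
    also have "\<dots> = (\<Sum>k\<le>n - m. fps_nth f k * (a ^ (n - m - k) / fact (n - m - k))) *
        (fact n / fact m)"
      unfolding sum_distrib_right
    proof (rule sum.cong[OF refl])
      fix k assume "k \<in> {..n - m}"
      then have k: "m \<le> n - k" "n - k - m = n - m - k" using True by auto
      show "?t k = fps_nth f k * (a ^ (n - m - k) / fact (n - m - k)) * (fact n / fact m)"
        using k by (simp add: binomial_fact field_simps)
    qed
    also have "\<dots> = fps_nth (f * fps_exp a) (n - m) * (fact n / fact m)"
      by (simp add: fps_mult_nth atMost_atLeast0)
    finally show ?thesis using True by (simp add: coeff_fps_apply_monom mult.commute)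
  next
    case False
    then show ?thesis by (auto simp: coeff_fps_apply_monom intro!: sum.neutral)
  qed
  finally show "coeff (pcompose (fps_apply_monom f n) [:a, 1:]) m =
    coeff (fps_apply_monom (fps_exp a * f) n) m" .
qed

lemma nth_symbol_fps_apply_monom:
  "s \<le> n \<Longrightarrow> fps_nth (symbol_fps n (fps_apply_monom f n)) s = fps_nth f s"
  by (simp add: symbol_fps_def coeff_fps_apply_monom)

text \<open>Coefficients of \<open>f * g\<close> up to index \<open>n\<close> involve only
  coefficients of \<open>f\<close> and \<open>g\<close> up to \<open>n\<close>, so the truncation in
  \<open>symbol_fps\<close> loses nothing.\<close>

lemma boxplus_fps_apply_monom:
  "boxplus n (fps_apply_monom f n) (fps_apply_monom g n) = fps_apply_monom (f * g) n"
proof (rule symbol_fps_eqD)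
  fix s assume s: "s \<le> n"
  then have "fps_nth (symbol_fps n (fps_apply_monom f n) * symbol_fps n (fps_apply_monom g n)) s =
      fps_nth (f * g) s"
    unfolding fps_mult_nth by (intro sum.cong) (auto simp: nth_symbol_fps_apply_monom)
  with s show "fps_nth (symbol_fps n (boxplus n (fps_apply_monom f n) (fps_apply_monom g n))) s =
      fps_nth (symbol_fps n (fps_apply_monom (f * g) n)) s"
    by (simp add: symbol_fps_boxplus degree_fps_apply_monom_le nth_symbol_fps_apply_monom)
qed (simp_all add: degree_boxplus_le degree_fps_apply_monom_le)

section \<open>The series of the falling factorials\<close>

text \<open>The series (exp(x) - 1)/x, given by its coefficients; its constant term 1 makes it
  invertible.\<close>

definition expm1_quot :: "complex fps" where
  "expm1_quot = Abs_fps (\<lambda>k. 1 / fact (Suc k))"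

lemma expm1_quot_nth_0: "fps_nth expm1_quot 0 = 1"
  by (simp add: expm1_quot_def)

lemma X_mult_expm1_quot: "fps_X * expm1_quot = fps_exp 1 - 1"
proof (rule fps_ext)
  show "fps_nth (fps_X * expm1_quot) k = fps_nth (fps_exp 1 - 1) k" for k
    by (cases k) (simp_all add: expm1_quot_def del: fact_Suc)
qed

lemma inverse_expm1_quot: "inverse expm1_quot * expm1_quot = 1"
  by (rule inverse_mult_eq_1) (simp add: expm1_quot_nth_0)

definition falling_symbol :: "nat \<Rightarrow> complex fps" where
  "falling_symbol n = fps_exp 1 * inverse expm1_quot ^ Suc n"

text \<open>This encodes (t)_{n+1} = (t - n) (t)_n: one has t f(D) t^n = f(D) t^(n+1) - f'(D) t^n,
  and t^n = D t^(n+1) / (n+1).\<close>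

lemma falling_symbol_Suc:
  "of_nat (Suc n) * falling_symbol (Suc n) =
     of_nat (Suc n) * falling_symbol n -
     fps_X * (fps_deriv (falling_symbol n) + of_nat n * falling_symbol n)"
proof -
  let ?h = expm1_quot and ?w = "inverse expm1_quot"
  have wh: "?w * ?h = 1" by (rule inverse_expm1_quot)
  have e: "fps_exp 1 = 1 + fps_X * ?h" by (simp add: X_mult_expm1_quot)
  have "fps_deriv (fps_X * ?h) = fps_exp 1" by (simp add: X_mult_expm1_quot)
  then have dh: "fps_X * fps_deriv ?h = 1 + fps_X * ?h - ?h"
    by (simp add: e algebra_simps)
  \<comment> \<open>Differentiating \<open>?w * ?h = 1\<close> gives w' = -w^2 h'. With
    \<open>dh\<close> this becomes the equation \<open>dw\<close>, from which h has
    disappeared.\<close>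
  have "fps_deriv (?w * ?h) = 0" by (simp add: wh)
  then have "?w * (?w * fps_deriv ?h + fps_deriv ?w * ?h) = 0"
    by (simp add: algebra_simps)
  then have "fps_deriv ?w * (?w * ?h) = - (?w * (?w * fps_deriv ?h))"
    by (simp add: algebra_simps eq_neg_iff_add_eq_0)
  then have "fps_X * fps_deriv ?w = - (?w * (?w * (fps_X * fps_deriv ?h)))"
    by (simp only: wh mult_1_right mult_minus_right mult.left_commute[of fps_X])
  also have "\<dots> = - (?w * (?w + fps_X * (?w * ?h) - ?w * ?h))"
    unfolding dh by (simp add: algebra_simps)
  finally have dw: "fps_X * fps_deriv ?w = - (?w * (?w + fps_X - 1))"
    by (simp add: wh)
  have "fps_deriv (?w ^ Suc n) = of_nat (Suc n) * ?w ^ n * fps_deriv ?w"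
    by (subst fps_deriv_power') (simp add: mult_ac del: of_nat_Suc power_Suc)
  then have "fps_X * fps_deriv (?w ^ Suc n) =
      of_nat (Suc n) * ?w ^ n * (fps_X * fps_deriv ?w)"
    by (simp only: ac_simps)
  also have "\<dots> = - of_nat (Suc n) * (?w ^ Suc n * (?w + fps_X - 1))"
    unfolding dw by (simp only: power_Suc minus_mult_left[symmetric] mult_minus_right ac_simps)
  finally have dp: "fps_X * fps_deriv (?w ^ Suc n) =
      - of_nat (Suc n) * (?w ^ Suc n * (?w + fps_X - 1))" .
  have "fps_X * fps_deriv (falling_symbol n) =
      fps_X * falling_symbol n + fps_exp 1 * (fps_X * fps_deriv (?w ^ Suc n))"
    unfolding falling_symbol_def by (simp add: algebra_simps del: power_Suc)
  also have "\<dots> =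
      fps_X * falling_symbol n - of_nat (Suc n) * (falling_symbol n * (?w + fps_X - 1))"
    unfolding dp falling_symbol_def
    by (simp only: mult_minus_left mult_minus_right diff_conv_add_uminus ac_simps)
  finally have "fps_X * fps_deriv (falling_symbol n) =
      fps_X * falling_symbol n - of_nat (Suc n) * (falling_symbol n * (?w + fps_X - 1))" .
  moreover have "falling_symbol (Suc n) = falling_symbol n * ?w"
    by (simp add: falling_symbol_def algebra_simps)
  ultimately show ?thesis by (simp add: algebra_simps)
qed

text \<open>The operator x d/dx multiplies the coefficient of index \<open>Suc j\<close> by j + 1,
  whence the factor (n+1) - (j+1) = n - j.\<close>

lemma nth_falling_symbol_Suc:
  "of_nat (Suc n) * fps_nth (falling_symbol (Suc n)) (Suc j) =
     (of_nat n - of_nat j) * fps_nth (falling_symbol n) (Suc j) -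
     of_nat n * fps_nth (falling_symbol n) j"
proof -
  have *: "fps_nth (of_nat a * f) k = of_nat a * fps_nth f k" for a k and f :: "complex fps"
    by (simp flip: fps_of_nat)
  show ?thesis
    using arg_cong[OF falling_symbol_Suc[of n], of "\<lambda>f. fps_nth f (Suc j)"]
    by (simp add: * algebra_simps del: of_nat_Suc) (simp add: algebra_simps)
qed

lemma falling_fact_eq: "falling_fact n = fps_apply_monom (falling_symbol n) n"
proof (induction n)
  case 0
  show ?case
    by (simp add: falling_fact_def fps_apply_monom_def falling_symbol_def expm1_quot_nth_0)
next
  case (Suc n)
  let ?g = "falling_symbol n"
  have rec: "coeff (falling_fact (Suc n)) m =
      (if m = 0 then 0 else coeff (falling_fact n) (m - 1)) - of_nat n * coeff (falling_fact n) m" for m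
    by (cases m) (simp_all add: falling_fact_def)
  show ?case
  proof (rule poly_eqI)
    fix m
    \<comment> \<open>The coefficient of t^m belongs to the series index n + 1 - m. For
      \<open>m = Suc n\<close> this is 0, which \<open>nth_falling_symbol_Suc\<close> does not
      cover; otherwise it is \<open>Suc j\<close>.\<close>
    consider "m > Suc n" | "m = Suc n" | j where "m \<le> n" "j = n - m" by force
    then show "coeff (falling_fact (Suc n)) m =
        coeff (fps_apply_monom (falling_symbol (Suc n)) (Suc n)) m"
    proof cases
      case 1
      then show ?thesis by (simp add: rec Suc.IH coeff_fps_apply_monom)
    next
      case 2
      then show ?thesis
        by (simp add: rec Suc.IH coeff_fps_apply_monom falling_symbol_def
            expm1_quot_nth_0 fps_nth_power_0 del: fact_Suc of_nat_Suc)
    next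
      case 3
      have nj: "of_nat n - of_nat j = (of_nat m :: complex)" using 3 by (simp add: of_nat_diff)
      have "coeff (fps_apply_monom (falling_symbol (Suc n)) (Suc n)) m =
          of_nat (Suc n) * fps_nth (falling_symbol (Suc n)) (Suc j) * (fact n / fact m)"
        using 3 by (simp add: coeff_fps_apply_monom Suc_diff_le del: of_nat_Suc)
      also have "\<dots> = (of_nat m * fps_nth ?g (Suc j) - of_nat n * fps_nth ?g j) * (fact n / fact m)"
        by (simp only: nth_falling_symbol_Suc nj)
      also have "\<dots> = coeff (falling_fact (Suc n)) m"
      \<comment> \<open>For \<open>m = 0\<close> the factor \<open>of_nat m\<close> vanishes,
        matching the absence of a preceding coefficient in \<open>rec\<close>.\<close>
      proof (cases m)
        case 0
        then show ?thesis using 3 by (simp add: rec Suc.IH coeff_fps_apply_monom)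
      next
        case (Suc k)
        with 3 have "n - k = Suc j" "n - Suc k = j" "Suc k \<le> n" by auto
        with Suc show ?thesis
          by (simp add: rec Suc.IH coeff_fps_apply_monom field_simps del: of_nat_Suc)
      qed
      finally show ?thesis by simp
    qed
  qed
qed

section \<open>The deviation polynomial and its centred form\<close>

text \<open>The series is the reciprocal of \<open>falling_symbol n\<close>; uniqueness of the
  inverse for \<open>boxplus n\<close> does the rest.\<close>

lemma deviation_poly_eq:
  "deviation_poly n = fps_apply_monom (fps_exp (-1) * expm1_quot ^ Suc n) n"
proof -
  let ?f = "fps_exp (-1) * expm1_quot ^ Suc n"
  have "?f * falling_symbol n =
      (fps_exp (-1) * fps_exp 1) * (inverse expm1_quot * expm1_quot) ^ Suc n"
    unfolding falling_symbol_def power_mult_distrib by (simp only: ac_simps)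
  also have "\<dots> = 1"
    by (simp add: inverse_expm1_quot flip: fps_exp_add_mult)
  finally have "boxplus n (fps_apply_monom ?f n) (falling_fact n) = monom 1 n"
    by (simp only: falling_fact_eq boxplus_fps_apply_monom fps_apply_monom_one)
  then show ?thesis
    using deviation_poly_ex1[of n] deviation_poly[of n] degree_fps_apply_monom_le[of ?f n] by blast
qed

text \<open>This is sinh(x/2)/(x/2), the even series obtained by centring (exp(x) - 1)/x.\<close>

definition central_quot :: "complex fps" where
  "central_quot = fps_exp (- (1/2)) * expm1_quot"

lemma central_quot_nth_0: "fps_nth central_quot 0 = 1"
  by (simp add: central_quot_def expm1_quot_nth_0)

lemma X_mult_central_quot: "fps_X * central_quot = fps_exp (1/2) - fps_exp (- (1/2))"
proof -
  have "fps_X * central_quot = fps_exp (- (1/2)) * (fps_exp 1 - 1)"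
    by (simp add: central_quot_def mult.left_commute flip: X_mult_expm1_quot)
  also have "\<dots> = fps_exp (1/2) - fps_exp (- (1/2))"
    by (simp add: right_diff_distrib flip: fps_exp_add_mult)
  finally show ?thesis .
qed

text \<open>Each of the n + 1 factors \<open>expm1_quot\<close> contributes exp(x/2) on centring.
  Together with exp(-x) this leaves exp((n-1)x/2), a translation.\<close>

lemma deviation_poly_shift:
  "deviation_poly n =
     pcompose (fps_apply_monom (central_quot ^ Suc n) n) [:(of_nat n - 1) / 2, 1:]"
proof -
  have "fps_exp ((of_nat n - 1) / 2) * central_quot ^ Suc n =
      (fps_exp ((of_nat n - 1) / 2) * fps_exp (of_nat (Suc n) * - (1/2))) * expm1_quot ^ Suc n"
    unfolding central_quot_def power_mult_distrib fps_exp_power_mult by (simp only: ac_simps)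
  also have "fps_exp ((of_nat n - 1) / 2) * fps_exp (of_nat (Suc n) * - (1/2)) =
      (fps_exp (-1) :: complex fps)"
    unfolding fps_exp_add_mult[symmetric]
    by (rule arg_cong[of _ _ fps_exp]) (simp add: field_simps)
  finally show ?thesis by (simp only: deviation_poly_eq pcompose_fps_apply_monom)
qed

section \<open>Location of the roots\<close>

text \<open>At equal height, the point farther from the imaginary axis is farther from every root,
  so each linear factor is larger there. Positive degree makes the product nonempty and the
  inequality strict.\<close>

lemma norm_poly_less_of_imaginary_roots:
  fixes p :: "complex poly"
  assumes deg: "degree p > 0" and roots: "\<And>r. poly p r = 0 \<Longrightarrow> Re r = 0"
    and close: "\<bar>Re z\<bar> < \<bar>Re w\<bar>" "Im z = Im w"
  shows "norm (poly p z) < norm (poly p w)"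
proof -
  obtain r where p: "smult (lead_coeff p) (\<Prod>i<degree p. [:- r i, 1:]) = p"
    using complex_poly_decompose' by metis
  have val: "poly p x = lead_coeff p * (\<Prod>i<degree p. x - r i)" for x
    by (subst p[symmetric]) (simp add: poly_prod)
  have "Re (r i) = 0" if "i < degree p" for i
    using that by (intro roots) (auto simp: val)
  moreover have "(Re z)\<^sup>2 < (Re w)\<^sup>2" using close(1)
    by (meson abs_le_square_iff not_le)
  ultimately have "norm (z - r i) < norm (w - r i)" if "i < degree p" for i
    using that close(2) by (simp add: cmod_def)
  moreover from this have "0 < norm (w - r i)" if "i < degree p" for i
    using that by (meson le_less_trans norm_ge_zero)
  ultimately have "(\<Prod>i<degree p. norm (z - r i)) < (\<Prod>i<degree p. norm (w - r i))"
    using deg by (intro prod_mono_strict[of 0]) (simp_all add: less_imp_le)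
  then show ?thesis
    using deg by (auto simp: val norm_mult prod_norm intro!: mult_strict_left_mono)
qed

text \<open>The points z + 1/2 and z - 1/2 have equal height, and are equally far from the imaginary
  axis only if Re z = 0.\<close>

lemma roots_central_difference:
  fixes p :: "complex poly"
  assumes "degree p > 0" and "\<And>r. poly p r = 0 \<Longrightarrow> Re r = 0"
    and "poly p (z + 1/2) = poly p (z - 1/2)"
  shows "Re z = 0"
proof (rule ccontr)
  assume "Re z \<noteq> 0"
  then consider "\<bar>Re (z - 1/2)\<bar> < \<bar>Re (z + 1/2)\<bar>" | "\<bar>Re (z + 1/2)\<bar> < \<bar>Re (z - 1/2)\<bar>"
    by fastforce
  then show False
    using norm_poly_less_of_imaginary_roots[OF assms(1,2)] assms(3) by cases fastforce+
qed

text \<open>The induction on \<open>j\<close> keeps \<open>n\<close> arbitrary, since lowering the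
  exponent raises the degree by one. It starts from t^n, which has no root other than 0.\<close>

lemma roots_central_quot_power:
  "poly (fps_apply_monom (central_quot ^ j) n) z = 0 \<Longrightarrow> Re z = 0"
proof (induction j arbitrary: n z)
  case 0
  then show ?case by (auto simp: fps_apply_monom_one poly_monom)
next
  case (Suc j)
  let ?p = "fps_apply_monom (central_quot ^ j) (Suc n)"
  have "smult (of_nat (Suc n)) (fps_apply_monom (central_quot ^ Suc j) n) =
      fps_apply_monom (fps_X * central_quot * central_quot ^ j) (Suc n)"
    by (simp only: fps_apply_monom_X_mult[symmetric] power_Suc mult.assoc)
  also have "\<dots> = pcompose ?p [:1/2, 1:] - pcompose ?p [:- (1/2), 1:]"
    by (simp only: X_mult_central_quot left_diff_distrib fps_apply_monom_diff
        pcompose_fps_apply_monom)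
  finally have "poly (smult (of_nat (Suc n)) (fps_apply_monom (central_quot ^ Suc j) n)) z =
      poly (pcompose ?p [:1/2, 1:] - pcompose ?p [:- (1/2), 1:]) z"
    by (rule arg_cong)
  then have "poly ?p (z + 1/2) = poly ?p (z - 1/2)" using Suc.prems
    by (simp add: poly_pcompose add.commute)
  \<comment> \<open>The constant term of \<open>central_quot ^ j\<close> is 1, so the degree is
    exactly \<open>Suc n\<close>.\<close>
  moreover have "degree ?p > 0"
    by (subst degree_fps_apply_monom) (simp_all add: fps_nth_power_0 central_quot_nth_0)
  ultimately show ?case using roots_central_difference[of ?p z] Suc.IH by blast
qed

theorem theorem1p7:
  fixes n :: nat and z :: complex
  assumes "n \<ge> 1" and "poly (deviation_poly n) z = 0"
  shows "Re z = - ((real n - 1) / 2)"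
proof -
  \<comment> \<open>A root z of the deviation polynomial corresponds to the root z + (n-1)/2 of the
    centred polynomial.\<close>
  have "Re ((of_nat n - 1) / 2 + z) = 0"
    using assms(2)
    by (intro roots_central_quot_power[of "Suc n" n]) (simp add: deviation_poly_shift poly_pcompose)
  then show ?thesis by simp
qed

end
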